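(* Let $p\in\mathbb{R}[x_1,\dots,x_n]$, and let $m_1<m_2<\cdots<m_k=\left|\tfrac12 N(p)\right|$ be the schedule of basis sizes used by the two-stage procedure described in the context (initial basis construction, followed if necessary by ordered expansion). Assume that the computational cost of solving a semidefinite program with basis size $m$ scales as $\Theta(m^\omega)$, where the exponent $\omega$ depends on the solver. Then the combined computational cost of the initial basis construction and the ordered expansion is at most $k$ times the cost of the standard Newton polytope approach.
   Context: $S(p)$ is the set of monomials appearing in $p$. The Newton polytope $N(p)$ is the convex hull of the exponent vectors of the monomials in $S(p)$. As a candidate set of monomials, $\tfrac12N(p)$ denotes $\{\mathbf{x}^\alpha:\alpha\in(\tfrac12N(p))\cap\mathbb{Z}_{\ge0}^n\}$, and $\left|\tfrac12N(p)\right|$ is its cardinality. For a finite set $B$ of monomials with vector of monomials $\mathbf{z}_B(\mathbf{x})$, the semidefinite program for $(B,p)$ asks for a positive semidefinite matrix $Q$ with $p(\mathbf{x})=\mathbf{z}_B(\mathbf{x})^\top Q\,\mathbf{z}_B(\mathbf{x})$; its basis size is $|B|$. Standard Newton polytope approach: solve the single semidefinite program whose basis is all of $\tfrac12N(p)$. Initial basis construction: a predicted set of monomials is greedily extended to a set $B_{\mathrm{cov}}$ such that every monomial of $S(p)$ is a product of two elements of $B_{\mathrm{cov}}$. The semidefinite program for $(B_{\mathrm{cov}},p)$, of size $m_1=|B_{\mathrm{cov}}|$, is solved, and the procedure stops if it is feasible. Ordered expansion: otherwise, form the list $M$ consisting of $B_{\mathrm{cov}}$ followed by the remaining monomials of $\tfrac12N(p)$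 sorted by a score. For $t=2,\dots,k$ in turn, solve the semidefinite program whose basis consists of the first $m_t$ monomials of $M$. Stop as soon as one is feasible; report infeasibility if none is. Computational cost is measured by the semidefinite program solves: a run that solves programs of basis sizes $m_1,\dots,m_j$ has total cost $\Theta\left(\sum_{i=1}^j m_i^\omega\right)$, and the standard approach has cost $\Theta\left(\left|\tfrac12N(p)\right|^\omega\right)$.
   Formalization: The exponent ω is assumed nonnegative and solver costs positive; the factor k is exact for the cost measures Σ m_i^ω and |½N(p)|^ω, while for the actual cost, known only as Θ(m^ω), the bound holds up to a constant independent of the instance. *)

theory Defs
  imports
    "HOL-Analysis.Finite_Function_Topology"
    "HOL-Analysis.Analysis"
    "HOL-Library.Landau_Symbols"
begin

text \<open>
  A monomial is identified with its finitely supported exponent vector, so that the product of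
  monomials is the sum of exponent vectors. The product on \<open>monom \<Rightarrow>\<^sub>0 real\<close> is the convolution
  product, i.e. the usual multiplication of polynomials in the variables with indices
  \<open>0, 1, 2, \<dots>\<close>.
\<close>

type_synonym monom = "nat \<Rightarrow>\<^sub>0 nat"
type_synonym mpoly = "monom \<Rightarrow>\<^sub>0 real"

definition polys :: "nat \<Rightarrow> mpoly set" where
  "polys n = {p. \<forall>\<alpha>\<in>Poly_Mapping.keys p. Poly_Mapping.keys \<alpha> \<subseteq> {..<n}}"

definition mons :: "mpoly \<Rightarrow> monom set" where
  "mons p = Poly_Mapping.keys p"

definition real_exponent :: "monom \<Rightarrow> (nat \<Rightarrow>\<^sub>0 real)" where
  "real_exponent \<alpha> = Poly_Mapping.map real \<alpha>"

definition newton_polytope :: "mpoly \<Rightarrow> (nat \<Rightarrow>\<^sub>0 real) set" where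
  "newton_polytope p = convex hull (real_exponent ` mons p)"

text \<open>
  For \<open>p \<in> polys n\<close>, all points of the Newton polytope vanish outside the first \<open>n\<close> coordinates,
  so the lattice points below are those in the nonnegative orthant of dimension \<open>n\<close>
  (see \<open>half_newton_in_n_variables\<close>).
\<close>

definition half_newton :: "mpoly \<Rightarrow> monom set" where
  "half_newton p = {\<alpha>. real_exponent \<alpha> \<in> (\<lambda>v. (1/2) *\<^sub>R v) ` newton_polytope p}"

lemma lookup_real_exponent:
  "Poly_Mapping.lookup (real_exponent \<alpha>) i = real (Poly_Mapping.lookup \<alpha> i)"
  unfolding real_exponent_def by (simp add: Poly_Mapping.map.rep_eq when_def)

lemma lookup_scaleR:
  "Poly_Mapping.lookup (r *\<^sub>R v) i = r *\<^sub>R Poly_Mapping.lookup (v :: nat \<Rightarrow>\<^sub>0 real) i"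
proof -
  have "finite {i. r *\<^sub>R Poly_Mapping.lookup v i \<noteq> 0}"
    by (rule finite_subset[OF _ finite_keys[of v]]) (auto simp: in_keys_iff)
  then show ?thesis
    by (simp add: scaleR_poly_mapping_def Abs_poly_mapping_inverse)
qed

lemma half_newton_in_n_variables:
  assumes "p \<in> polys n" and "\<alpha> \<in> half_newton p"
  shows "Poly_Mapping.keys \<alpha> \<subseteq> {..<n}"
proof -
  let ?V = "{v :: nat \<Rightarrow>\<^sub>0 real. \<forall>i\<ge>n. Poly_Mapping.lookup v i = 0}"
  have "convex ?V"
    by (simp add: convex_def lookup_add lookup_scaleR)
  moreover have "real_exponent ` mons p \<subseteq> ?V"
    using assms(1)
    by (fastforce simp: polys_def mons_def lookup_real_exponent in_keys_iff subset_iff)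
  ultimately have "newton_polytope p \<subseteq> ?V"
    unfolding newton_polytope_def by (rule hull_minimal[rotated])
  with assms(2) obtain v where v: "v \<in> ?V" "real_exponent \<alpha> = (1/2) *\<^sub>R v"
    unfolding half_newton_def by blast
  have "Poly_Mapping.lookup \<alpha> i = 0" if "i \<ge> n" for i
    using arg_cong[OF v(2), of "\<lambda>w. Poly_Mapping.lookup w i"] v(1) that
    by (simp add: lookup_real_exponent lookup_scaleR)
  then show ?thesis
    by (metis in_keys_iff lessThan_iff linorder_not_le subsetI)
qed

definition psd_on :: "'a set \<Rightarrow> ('a \<Rightarrow> 'a \<Rightarrow> real) \<Rightarrow> bool" where
  "psd_on B Q \<longleftrightarrow>
     (\<forall>\<alpha>\<in>B. \<forall>\<beta>\<in>B. Q \<alpha> \<beta> = Q \<beta> \<alpha>) \<and>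
     (\<forall>v :: 'a \<Rightarrow> real. 0 \<le> (\<Sum>\<alpha>\<in>B. \<Sum>\<beta>\<in>B. v \<alpha> * Q \<alpha> \<beta> * v \<beta>))"

text \<open>The product of three singletons is \<open>x\<^sup>\<alpha> \<cdot> Q\<^sub>\<alpha>\<^sub>\<beta> \<cdot> x\<^sup>\<beta>\<close>, with the matrix entry as a constant
  polynomial.\<close>

definition sdp_feasible :: "monom set \<Rightarrow> mpoly \<Rightarrow> bool" where
  "sdp_feasible B p \<longleftrightarrow>
     (\<exists>Q. psd_on B Q \<and>
       p = (\<Sum>\<alpha>\<in>B. \<Sum>\<beta>\<in>B. Poly_Mapping.single \<alpha> 1 * Poly_Mapping.single 0 (Q \<alpha> \<beta>)
                               * Poly_Mapping.single \<beta> 1))"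

text \<open>
  \<open>B\<close> is any outcome of extending the predicted set \<open>P\<close>, by monomials of the candidate set, until
  all of \<open>S(p)\<close> is covered; the selection rule of the extension is left open.
\<close>

definition initial_basis :: "mpoly \<Rightarrow> monom set \<Rightarrow> monom set \<Rightarrow> bool" where
  "initial_basis p P B \<longleftrightarrow>
     P \<subseteq> B \<and> B \<subseteq> half_newton p \<and> (\<forall>\<gamma>\<in>mons p. \<exists>\<alpha>\<in>B. \<exists>\<beta>\<in>B. \<gamma> = \<alpha> + \<beta>)"

text \<open>Ties in the score are broken arbitrarily. As the score is an arbitrary real function, the
  direction of sorting is immaterial.\<close>

definition expansion_order :: "mpoly \<Rightarrow> monom set \<Rightarrow> (monom \<Rightarrow> real) \<Rightarrow> monom list \<Rightarrow> bool" where
  "expansion_order p B score M \<longleftrightarrow>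
     (\<exists>xs ys. M = xs @ ys \<and> distinct xs \<and> set xs = B \<and>
        distinct ys \<and> set ys = half_newton p - B \<and>
        sorted_wrt (\<lambda>\<alpha> \<beta>. score \<alpha> \<ge> score \<beta>) ys)"

text \<open>\<open>ms = [m\<^sub>1, \<dots>, m\<^sub>k]\<close>.\<close>

definition size_schedule :: "mpoly \<Rightarrow> monom set \<Rightarrow> nat list \<Rightarrow> bool" where
  "size_schedule p B ms \<longleftrightarrow>
     ms \<noteq> [] \<and> sorted_wrt (<) ms \<and> hd ms = card B \<and> last ms = card (half_newton p)"

definition two_stage_setup ::
  "mpoly \<Rightarrow> monom set \<Rightarrow> monom set \<Rightarrow> (monom \<Rightarrow> real) \<Rightarrow> monom list \<Rightarrow> nat list \<Rightarrow> bool" where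
  "two_stage_setup p P B score M ms \<longleftrightarrow>
     initial_basis p P B \<and> expansion_order p B score M \<and> size_schedule p B ms"

text \<open>
  The sizes of the programs that are actually solved: the run stops after the first feasible one.
  In a \<open>two_stage_setup\<close> the first \<open>m\<^sub>1\<close> entries of \<open>M\<close> form the initial basis, so the first
  program is that of the initial basis construction.
\<close>

fun solved_sizes :: "mpoly \<Rightarrow> monom list \<Rightarrow> nat list \<Rightarrow> nat list" where
  "solved_sizes p M [] = []"
| "solved_sizes p M (m # ms) =
     m # (if sdp_feasible (set (take m M)) p then [] else solved_sizes p M ms)"

text \<open>In the following, \<open>c m\<close> is the cost of solving a program of basis size \<open>m\<close>.\<close>

definition two_stage_cost :: "(nat \<Rightarrow> real) \<Rightarrow> mpoly \<Rightarrow> monom list \<Rightarrow> nat list \<Rightarrow> real" where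
  "two_stage_cost c p M ms = (\<Sum>m\<leftarrow>solved_sizes p M ms. c m)"

definition standard_cost :: "(nat \<Rightarrow> real) \<Rightarrow> mpoly \<Rightarrow> real" where
  "standard_cost c p = c (card (half_newton p))"

end

theory Submission
  imports Defs
begin

text \<open>
  Every program solved has a size in the increasing schedule, hence of size at most
  \<open>m\<^sub>k = |\<onehalf>N(p)|\<close>, and there are at most \<open>k\<close> of them. It remains to compare single costs. The power
  \<open>m\<^sup>\<omega>\<close> is monotone. A cost \<open>c \<in> \<Theta>(m\<^sup>\<omega>)\<close> need not be, but since \<open>c\<close> is positive
  the two-sided estimate holds from size \<open>1\<close> on with uniform constants, so \<open>c m \<le> C \<cdot> c L\<close> whenever
  \<open>m \<le> L\<close>, with \<open>C\<close> independent of the instance.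
\<close>

lemma set_solved_sizes_subset: "set (solved_sizes p M ms) \<subseteq> set ms"
  by (induction ms) auto

lemma length_solved_sizes_le: "length (solved_sizes p M ms) \<le> length ms"
  by (induction ms) auto

lemma sorted_wrt_less_le_last:
  fixes xs :: "'a :: preorder list"
  assumes "sorted_wrt (<) xs" "x \<in> set xs"
  shows "x \<le> last xs"
  using assms by (induction xs) (auto simp: order.strict_implies_order)

lemma size_schedule_le:
  assumes "size_schedule p B ms" "m \<in> set ms"
  shows "m \<le> card (half_newton p)"
  using sorted_wrt_less_le_last[of ms m] assms by (auto simp: size_schedule_def)

lemma sum_list_map_le_length_mult:
  fixes f :: "'a \<Rightarrow> real"
  assumes "\<And>x. x \<in> set xs \<Longrightarrow> f x \<le> K"
  shows "(\<Sum>x\<leftarrow>xs. f x) \<le> real (length xs) * K"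
  using sum_list_mono[of xs f "\<lambda>_. K"] assms by (simp add: sum_list_triv)

text \<open>\<open>K\<close> is left open so that the bound serves both the exact power and a
  general cost. A run may stop early, so \<open>0 \<le> K\<close> is what allows the number of
  solved programs to be raised to \<open>length ms\<close>.\<close>

lemma two_stage_cost_le:
  assumes "size_schedule p B ms" "0 \<le> K"
    and "\<And>m. m \<le> card (half_newton p) \<Longrightarrow> f m \<le> K"
  shows "two_stage_cost f p M ms \<le> real (length ms) * K"
proof -
  have "f m \<le> K" if "m \<in> set (solved_sizes p M ms)" for m
    using that set_solved_sizes_subset size_schedule_le[OF assms(1)] assms(3) by blast
  then have "two_stage_cost f p M ms \<le> real (length (solved_sizes p M ms)) * K"
    unfolding two_stage_cost_def by (rule sum_list_map_le_length_mult)
  also have "\<dots> \<le> real (length ms) * K"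
    using length_solved_sizes_le assms(2) by (intro mult_right_mono) auto
  finally show ?thesis .
qed

text \<open>The asymptotic estimate bounds all but finitely many quotients, and finitely many values
  are bounded anyway. Zeros of \<open>g\<close> do no harm, since division by zero yields
  \<open>0\<close>.\<close>

lemma bigo_nat_imp_quotient_bounded:
  fixes f g :: "nat \<Rightarrow> real"
  assumes "f \<in> O(g)"
  obtains K where "K > 0" "\<And>n. \<bar>f n / g n\<bar> \<le> K"
proof -
  obtain A where "A > 0" "\<forall>\<^sub>F n in sequentially. \<bar>f n\<bar> \<le> A * \<bar>g n\<bar>"
    using landau_o.bigE[OF assms] by auto
  then have "\<forall>\<^sub>F n in sequentially. norm (f n / g n) \<le> A"
    by (elim eventually_mono) (auto simp: divide_le_eq)
  then have "Bseq (\<lambda>n. f n / g n)"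
    by (rule BfunI)
  then show thesis
    using that by (auto elim: BseqE)
qed

lemma bigtheta_powr_quasi_mono:
  fixes c :: "nat \<Rightarrow> real"
  assumes "0 \<le> \<omega>" and c0: "0 \<le> c 0" and pos: "\<And>m. 0 < m \<Longrightarrow> 0 < c m"
    and "c \<in> \<Theta>(\<lambda>m. real m powr \<omega>)"
  obtains C where "C > 0" "\<And>m L. m \<le> L \<Longrightarrow> c m \<le> C * c L"
proof -
  let ?g = "\<lambda>m. real m powr \<omega>"
  have O: "c \<in> O(?g)" "?g \<in> O(c)"
    using assms(4) by (auto simp: bigtheta_def bigomega_iff_bigo)
  from bigo_nat_imp_quotient_bounded[OF O(1)] obtain K1
    where K1: "K1 > 0" "\<And>n. \<bar>c n / ?g n\<bar> \<le> K1" by blast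
  from bigo_nat_imp_quotient_bounded[OF O(2)] obtain K2
    where K2: "K2 > 0" "\<And>n. \<bar>?g n / c n\<bar> \<le> K2" by blast
  \<comment> \<open>\<open>K1 * K2\<close> chains the two estimates through the power,
    \<open>c 0\<close> pays for \<open>m = 0\<close>, and the summand \<open>1\<close> gives
    \<open>C \<ge> 1\<close>, which settles \<open>m = L = 0\<close>.\<close>
  define C where "C = 1 + (K1 + c 0) * K2"
  have "C \<ge> 1"
    using K1(1) K2(1) c0 by (simp add: C_def)
  have "c m \<le> C * c L" if "m \<le> L" for m L
  proof (cases "L = 0")
    case True
    then show ?thesis
      using that c0 \<open>C \<ge> 1\<close> by (simp add: mult_le_cancel_right1)
  next
    case False
    then have L: "0 < c L" "1 \<le> ?g L"
      using pos \<open>0 \<le> \<omega>\<close> by (auto intro: ge_one_powr_ge_zero)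
    have "c m \<le> (K1 + c 0) * ?g L"
    proof (cases "m = 0")
      case True
      \<comment> \<open>\<open>K1\<close> says nothing about \<open>c 0\<close>, because
        \<open>0 powr \<omega> = 0\<close> makes that quotient \<open>0\<close>; instead
        \<open>?g L \<ge> 1\<close> absorbs it.\<close>
      then have "c m \<le> c 0 * ?g L"
        using mult_left_mono[OF L(2) c0] by simp
      then show ?thesis
        using K1(1) by (simp add: distrib_right add_increasing)
    next
      case False
      then have "c m \<le> K1 * ?g m"
        using K1(2)[of m] by (simp add: abs_le_iff pos_divide_le_eq)
      also have "\<dots> \<le> (K1 + c 0) * ?g L"
        using that K1(1) c0 \<open>0 \<le> \<omega>\<close> by (intro mult_mono powr_mono2) auto
      finally show ?thesis .
    qed
    also have "?g L \<le> K2 * c L"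
      using K2(2)[of L] L by (simp add: abs_le_iff pos_divide_le_eq)
    then have "(K1 + c 0) * ?g L \<le> (K1 + c 0) * (K2 * c L)"
      using K1(1) c0 by (intro mult_left_mono) auto
    also have "\<dots> \<le> C * c L"
      using L(1) by (simp add: C_def algebra_simps)
    finally show ?thesis .
  qed
  with \<open>C \<ge> 1\<close> show thesis
    by (intro that[of C]) auto
qed

text \<open>For the model cost \<open>m powr \<omega>\<close> the factor is exactly
  \<open>k = length ms\<close>; for a cost known only up to \<Theta>, a constant \<open>C\<close>
  fixed before the instance is allowed.\<close>

theorem lemma5:
  fixes \<omega> :: real and c :: "nat \<Rightarrow> real"
  assumes "0 \<le> \<omega>"
    and "0 \<le> c 0" and "\<And>m. 0 < m \<Longrightarrow> 0 < c m"
    and "c \<in> \<Theta>(\<lambda>m. real m powr \<omega>)"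
  shows "\<exists>C>0. \<forall>n p P B score M ms.
    p \<in> polys n \<longrightarrow> two_stage_setup p P B score M ms \<longrightarrow>
      two_stage_cost (\<lambda>m. real m powr \<omega>) p M ms
        \<le> real (length ms) * standard_cost (\<lambda>m. real m powr \<omega>) p \<and>
      two_stage_cost c p M ms \<le> C * (real (length ms) * standard_cost c p)"
proof -
  obtain C where C: "C > 0" "\<And>m L. m \<le> L \<Longrightarrow> c m \<le> C * c L"
    using bigtheta_powr_quasi_mono[OF assms] by blast
  \<comment> \<open>Size \<open>0\<close> counts too: for \<open>p = 0\<close> the candidate set is
    empty, and the bound \<open>C * standard_cost c p\<close> must still be nonnegative.\<close>
  have nonneg: "0 \<le> c m" for m
    using assms(2,3) by (cases "m = 0") (auto intro: less_imp_le)
  have "two_stage_cost (\<lambda>m. real m powr \<omega>) p M ms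
          \<le> real (length ms) * standard_cost (\<lambda>m. real m powr \<omega>) p"
    and "two_stage_cost c p M ms \<le> C * (real (length ms) * standard_cost c p)"
    if "two_stage_setup p P B score M ms" for p P B score M ms
  proof -
    have ms: "size_schedule p B ms"
      using that by (simp add: two_stage_setup_def)
    show "two_stage_cost (\<lambda>m. real m powr \<omega>) p M ms
            \<le> real (length ms) * standard_cost (\<lambda>m. real m powr \<omega>) p"
      unfolding standard_cost_def using assms(1)
      by (intro two_stage_cost_le[OF ms] powr_mono2) auto
    have "two_stage_cost c p M ms \<le> real (length ms) * (C * standard_cost c p)"
      unfolding standard_cost_def using C nonneg
      by (intro two_stage_cost_le[OF ms]) (auto intro!: mult_nonneg_nonneg less_imp_le)
    then show "two_stage_cost c p M ms \<le> C * (real (length ms) * standard_cost c p)"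
      by (simp only: mult.left_commute)
  qed
  with C(1) show ?thesis
    by blast
qed

end
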